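(* Let $(X,\mu)$ and $(Y,\nu)$ be strong generalized topological spaces and let $f:(X,\mu)\to(Y,\nu)$ be a surjective mapping. Then the following conditions are equivalent. (1) $f$ is a $g$-open mapping. (2) For every $B\subseteq Y$, $f^{-1}(C(B))\subseteq C(f^{-1}(B))$. (3) For every $A\subseteq X$, $f(I(A))\subseteq I(f(A))$. (4) For each $x\in X$, if $x\in U\in\mu$, then $f(x)\in V\subseteq f(U)$ for some $V\in\nu$.
   Context: A generalized topological space is a pair $(X,\mu)$ where $X$ is a set and $\mu$ is a family of subsets of $X$ such that $\emptyset\in\mu$ and any union of elements of $\mu$ belongs to $\mu$ (intersections are not required to belong to $\mu$). It is strong if $X\in\mu$. A set $B\subseteq X$ is $\mu$-open if $B\in\mu$, and $\mu$-closed if $X\setminus B\in\mu$. The interior $I(B)$ is the union of all $\mu$-open subsets of $B$, and the closure $C(B)$ is the intersection of all $\mu$-closed sets containing $B$; interiors and closures are taken in the space of which the set is a subset ($(X,\mu)$ or $(Y,\nu)$). No continuity of $f$ is assumed. The mapping $f$ is $g$-open if $f(U)\in\nu$ for each $U\in\mu$. *)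

theory Defs
  imports Main
begin

definition gen_topology :: "'a set \<Rightarrow> 'a set set \<Rightarrow> bool" where
  "gen_topology X \<mu> \<longleftrightarrow> \<mu> \<subseteq> Pow X \<and> {} \<in> \<mu> \<and> (\<forall>\<U>. \<U> \<subseteq> \<mu> \<longrightarrow> \<Union>\<U> \<in> \<mu>)"

definition strong_gen_topology :: "'a set \<Rightarrow> 'a set set \<Rightarrow> bool" where
  "strong_gen_topology X \<mu> \<longleftrightarrow> gen_topology X \<mu> \<and> X \<in> \<mu>"

definition gt_closed :: "'a set \<Rightarrow> 'a set set \<Rightarrow> 'a set \<Rightarrow> bool" where
  "gt_closed X \<mu> B \<longleftrightarrow> B \<subseteq> X \<and> X - B \<in> \<mu>"

definition gt_interior :: "'a set set \<Rightarrow> 'a set \<Rightarrow> 'a set" where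
  "gt_interior \<mu> B = \<Union>{U. U \<in> \<mu> \<and> U \<subseteq> B}"

(* For B a subset of X the family is nonempty: it contains X, since {} is open. *)
definition gt_closure :: "'a set \<Rightarrow> 'a set set \<Rightarrow> 'a set \<Rightarrow> 'a set" where
  "gt_closure X \<mu> B = \<Inter>{F. gt_closed X \<mu> F \<and> B \<subseteq> F}"

definition g_open_map :: "'a set set \<Rightarrow> 'b set set \<Rightarrow> ('a \<Rightarrow> 'b) \<Rightarrow> bool" where
  "g_open_map \<mu> \<nu> f \<longleftrightarrow> (\<forall>U\<in>\<mu>. f ` U \<in> \<nu>)"

end

theory Submission
  imports Defs
begin

text \<open>
  Interior, closure and openness can all be expressed through open neighbourhoods of points: for
  the closure this is De Morgan duality, and for openness it is closure of the family under
  arbitrary unions. The theorem is a comparison of these pointwise descriptions.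

  The neighbourhood condition says that \<open>f ` U\<close>, for \<open>U\<close> open, is a neighbourhood of each of its
  points, which amounts to openness of \<open>f ` U\<close> because open sets are closed under unions. The
  interior condition for the open set \<open>A = U\<close> says the same thing. The closure condition for
  \<open>B = Y - f ` U\<close> does so contrapositively: the preimage of \<open>B\<close> misses \<open>U\<close>, so a point \<open>x \<in> U\<close> is
  not in its closure, hence \<open>f x\<close> is not in the closure of \<open>B\<close>, which means that \<open>f x\<close> has an open
  neighbourhood inside \<open>f ` U\<close>. Conversely, an open map carries open neighbourhoods of \<open>x\<close> to open
  neighbourhoods of \<open>f x\<close>, and this gives the interior and closure conditions at each point.
\<close>

lemma gen_topology_open_iff_nbhd:
  assumes "gen_topology X \<mu>"
  shows "W \<in> \<mu> \<longleftrightarrow> (\<forall>w\<in>W. \<exists>V\<in>\<mu>. w \<in> V \<and> V \<subseteq> W)"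
proof
  assume "\<forall>w\<in>W. \<exists>V\<in>\<mu>. w \<in> V \<and> V \<subseteq> W"
  then have "W = \<Union>{V \<in> \<mu>. V \<subseteq> W}"
    by auto
  moreover have "\<Union>{V \<in> \<mu>. V \<subseteq> W} \<in> \<mu>"
    using assms unfolding gen_topology_def by simp
  ultimately show "W \<in> \<mu>"
    by simp
qed blast

lemma gt_interior_iff_nbhd:
  "x \<in> gt_interior \<mu> A \<longleftrightarrow> (\<exists>U\<in>\<mu>. x \<in> U \<and> U \<subseteq> A)"
  unfolding gt_interior_def by blast

text \<open>
  Complementation turns the closed sets containing \<open>B\<close> into the open sets disjoint from \<open>B\<close>, so a
  point fails to be in the closure exactly when it lies in one of the latter. The conjunct
  \<open>x \<in> X\<close> reflects that \<open>X\<close> itself is one of the closed sets, the empty set being open.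
\<close>

lemma gt_closure_iff_nbhd:
  assumes "gen_topology X \<mu>" and "B \<subseteq> X"
  shows "x \<in> gt_closure X \<mu> B \<longleftrightarrow> x \<in> X \<and> (\<forall>U\<in>\<mu>. x \<in> U \<longrightarrow> U \<inter> B \<noteq> {})"
proof (intro iffI conjI ballI impI)
  assume x: "x \<in> gt_closure X \<mu> B"
  have "gt_closed X \<mu> X"
    using assms(1) unfolding gt_closed_def gen_topology_def by simp
  then show "x \<in> X"
    using x assms(2) unfolding gt_closure_def by blast
  fix U assume U: "U \<in> \<mu>" "x \<in> U"
  show "U \<inter> B \<noteq> {}"
  proof
    assume "U \<inter> B = {}"
    moreover have "U \<subseteq> X"
      using assms(1) U(1) unfolding gen_topology_def by blast
    ultimately have "gt_closed X \<mu> (X - U)" "B \<subseteq> X - U"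
      using U(1) assms(2) unfolding gt_closed_def by (auto simp: double_diff)
    then show False
      using x U(2) unfolding gt_closure_def by blast
  qed
next
  assume "x \<in> X \<and> (\<forall>U\<in>\<mu>. x \<in> U \<longrightarrow> U \<inter> B \<noteq> {})"
  then show "x \<in> gt_closure X \<mu> B"
    unfolding gt_closure_def gt_closed_def by blast
qed

lemma g_open_map_iff_nbhd:
  assumes "gen_topology X \<mu>" and "gen_topology Y \<nu>"
  shows "g_open_map \<mu> \<nu> f \<longleftrightarrow>
    (\<forall>x\<in>X. \<forall>U\<in>\<mu>. x \<in> U \<longrightarrow> (\<exists>V\<in>\<nu>. f x \<in> V \<and> V \<subseteq> f ` U))"
proof -
  have "U \<subseteq> X" if "U \<in> \<mu>" for U
    using assms(1) that unfolding gen_topology_def by blast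
  moreover have "f ` U \<in> \<nu> \<longleftrightarrow> (\<forall>x\<in>U. \<exists>V\<in>\<nu>. f x \<in> V \<and> V \<subseteq> f ` U)" for U
    using gen_topology_open_iff_nbhd[OF assms(2), of "f ` U"] by simp
  ultimately show ?thesis
    unfolding g_open_map_def by (meson subsetD)
qed

lemma g_open_map_iff_image_interior:
  assumes "gen_topology X \<mu>" and "gen_topology Y \<nu>"
  shows "g_open_map \<mu> \<nu> f \<longleftrightarrow>
    (\<forall>A. A \<subseteq> X \<longrightarrow> f ` gt_interior \<mu> A \<subseteq> gt_interior \<nu> (f ` A))"
proof (intro iffI allI impI)
  fix A assume f: "g_open_map \<mu> \<nu> f"
  show "f ` gt_interior \<mu> A \<subseteq> gt_interior \<nu> (f ` A)"
  proof (rule image_subsetI)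
    fix x assume "x \<in> gt_interior \<mu> A"
    then obtain U where "U \<in> \<mu>" "x \<in> U" "U \<subseteq> A"
      unfolding gt_interior_iff_nbhd by blast
    then have "f ` U \<in> \<nu>" "f x \<in> f ` U" "f ` U \<subseteq> f ` A"
      using f by (auto simp: g_open_map_def)
    then show "f x \<in> gt_interior \<nu> (f ` A)"
      unfolding gt_interior_iff_nbhd by (intro bexI conjI)
  qed
next
  assume interior: "\<forall>A. A \<subseteq> X \<longrightarrow> f ` gt_interior \<mu> A \<subseteq> gt_interior \<nu> (f ` A)"
  show "g_open_map \<mu> \<nu> f"
    unfolding g_open_map_iff_nbhd[OF assms]
  proof (intro ballI impI)
    fix x U assume U: "U \<in> \<mu>" "x \<in> U"
    then have "U \<subseteq> X" "x \<in> gt_interior \<mu> U"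
      using assms(1) unfolding gen_topology_def by (auto simp: gt_interior_iff_nbhd)
    then have "f x \<in> gt_interior \<nu> (f ` U)"
      using interior by blast
    then show "\<exists>V\<in>\<nu>. f x \<in> V \<and> V \<subseteq> f ` U"
      by (simp add: gt_interior_iff_nbhd)
  qed
qed

lemma g_open_map_iff_vimage_closure:
  assumes "gen_topology X \<mu>" and "gen_topology Y \<nu>" and "f ` X \<subseteq> Y"
  shows "g_open_map \<mu> \<nu> f \<longleftrightarrow>
    (\<forall>B. B \<subseteq> Y \<longrightarrow> f -` gt_closure Y \<nu> B \<inter> X \<subseteq> gt_closure X \<mu> (f -` B \<inter> X))"
proof (intro iffI allI impI subsetI)
  fix B x
  assume f: "g_open_map \<mu> \<nu> f" and B: "B \<subseteq> Y" and x: "x \<in> f -` gt_closure Y \<nu> B \<inter> X"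
  have "U \<inter> (f -` B \<inter> X) \<noteq> {}" if U: "U \<in> \<mu>" "x \<in> U" for U
  proof -
    have "f ` U \<in> \<nu>" "f x \<in> f ` U"
      using f U by (auto simp: g_open_map_def)
    moreover have "f x \<in> gt_closure Y \<nu> B"
      using x by simp
    ultimately have "f ` U \<inter> B \<noteq> {}"
      unfolding gt_closure_iff_nbhd[OF assms(2) B] by simp
    moreover have "U \<subseteq> X"
      using assms(1) U(1) unfolding gen_topology_def by blast
    ultimately show ?thesis
      by blast
  qed
  then show "x \<in> gt_closure X \<mu> (f -` B \<inter> X)"
    using x by (simp add: gt_closure_iff_nbhd[OF assms(1)])
next
  assume closure: "\<forall>B. B \<subseteq> Y \<longrightarrow>
    f -` gt_closure Y \<nu> B \<inter> X \<subseteq> gt_closure X \<mu> (f -` B \<inter> X)"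
  show "g_open_map \<mu> \<nu> f"
    unfolding g_open_map_iff_nbhd[OF assms(1,2)]
  proof (intro ballI impI)
    fix x U assume x: "x \<in> X" and U: "U \<in> \<mu>" "x \<in> U"
    let ?B = "Y - f ` U"
    have "U \<inter> (f -` ?B \<inter> X) = {}"
      by blast
    then have "x \<notin> gt_closure X \<mu> (f -` ?B \<inter> X)"
      using U by (auto simp: gt_closure_iff_nbhd[OF assms(1)])
    then have "f x \<notin> gt_closure Y \<nu> ?B"
      using closure[rule_format, of ?B] x by auto
    moreover have "f x \<in> Y"
      using x assms(3) by blast
    ultimately obtain V where "V \<in> \<nu>" "f x \<in> V" "V \<inter> ?B = {}"
      by (auto simp: gt_closure_iff_nbhd[OF assms(2)])
    moreover from this have "V \<subseteq> Y"
      using assms(2) unfolding gen_topology_def by blast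
    ultimately show "\<exists>V\<in>\<nu>. f x \<in> V \<and> V \<subseteq> f ` U"
      by blast
  qed
qed

theorem theorem1:
  fixes X :: "'a set" and \<mu> :: "'a set set"
    and Y :: "'b set" and \<nu> :: "'b set set"
    and f :: "'a \<Rightarrow> 'b"
  assumes "strong_gen_topology X \<mu>"
    and "strong_gen_topology Y \<nu>"
    and "f ` X = Y"
  shows "(g_open_map \<mu> \<nu> f \<longleftrightarrow>
            (\<forall>B. B \<subseteq> Y \<longrightarrow> f -` gt_closure Y \<nu> B \<inter> X \<subseteq> gt_closure X \<mu> (f -` B \<inter> X)))
       \<and> (g_open_map \<mu> \<nu> f \<longleftrightarrow>
            (\<forall>A. A \<subseteq> X \<longrightarrow> f ` gt_interior \<mu> A \<subseteq> gt_interior \<nu> (f ` A)))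
       \<and> (g_open_map \<mu> \<nu> f \<longleftrightarrow>
            (\<forall>x\<in>X. \<forall>U\<in>\<mu>. x \<in> U \<longrightarrow> (\<exists>V\<in>\<nu>. f x \<in> V \<and> V \<subseteq> f ` U)))"
proof -
  have X: "gen_topology X \<mu>" and Y: "gen_topology Y \<nu>" and f: "f ` X \<subseteq> Y"
    using assms unfolding strong_gen_topology_def by simp_all
  show ?thesis
    using g_open_map_iff_vimage_closure[OF X Y f] g_open_map_iff_image_interior[OF X Y]
      g_open_map_iff_nbhd[OF X Y]
    by (intro conjI)
qed

end
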